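(* Let $m\in\mathbb{N}$, $k\in\mathbb{Z}$ and $n\in\mathbb{R}$. Assume that the compact set $$M=\Big\{(\tilde x_j,x_j)_{j=1}^m:\ \tfrac12\le\tilde x_j\le x_j\le1\ (1\le j\le m),\ \sum_{j=1}^m\tilde x_j=k,\ \sum_{j=1}^mx_j\le n\Big\}$$ is non-empty, and let $f(\tilde x,x)=\sum_{j=1}^m\tilde x_j\log x_j$ for $(\tilde x,x)=(\tilde x_j,x_j)_{j=1}^m\in M$. Then $$\max_{(\tilde x,x)\in M}f(\tilde x,x)=\begin{cases}0&\text{if }n\ge m,\\ (m-k)\log\Big(\dfrac{m+n-2k}{2(m-k)}\Big)&\text{if }n<m,\end{cases}$$ with the convention that the second line equals $0$ when $k=m$. Moreover, if $n<m$, then $r:=2k-m\in\mathbb{Z}$ satisfies $0\le r\le m$, and the maximum is attained at the point $(\tilde x_j,x_j)_{j=1}^m$ given by $$(\tilde x_j,x_j)=(1,1)\ \text{ for } j=1,\dots,r,\qquad(\tilde x_j,x_j)=\big(\tfrac12,c\big)\ \text{ for } j=r+1,\dots,m,$$ where $$c=\frac{n-r}{m-r}=\frac{m+n-2k}{2(m-k)}\in\big[\tfrac12,1\big).$$ *)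

theory Defs
  imports "HOL-Analysis.Analysis"
begin

text \<open>
  A point \<open>(x\<^sup>~\<^sub>j, x\<^sub>j)\<close>, \<open>j = 1, \<dots>, m\<close>, is a function \<open>z :: nat \<Rightarrow> real \<times> real\<close>
  with \<open>fst (z j) = x\<^sup>~\<^sub>j\<close> and \<open>snd (z j) = x\<^sub>j\<close>, taken extensional on \<open>{1..m}\<close> so that
  points correspond one-to-one to \<open>m\<close>-tuples of pairs; the product topology on the function
  type then restricts to the usual topology on these tuples.
\<close>

definition feasible_set :: "nat \<Rightarrow> int \<Rightarrow> real \<Rightarrow> (nat \<Rightarrow> real \<times> real) set" where
  "feasible_set m k n =
    {z \<in> {1..m} \<rightarrow>\<^sub>E UNIV.
      (\<forall>j\<in>{1..m}. 1/2 \<le> fst (z j) \<and> fst (z j) \<le> snd (z j) \<and> snd (z j) \<le> 1) \<and>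
      (\<Sum>j=1..m. fst (z j)) = real_of_int k \<and>
      (\<Sum>j=1..m. snd (z j)) \<le> n}"

definition objective :: "nat \<Rightarrow> (nat \<Rightarrow> real \<times> real) \<Rightarrow> real" where
  "objective m z = (\<Sum>j=1..m. fst (z j) * ln (snd (z j)))"

definition is_maximum_on :: "('a \<Rightarrow> real) \<Rightarrow> 'a set \<Rightarrow> real \<Rightarrow> bool" where
  "is_maximum_on f S v \<longleftrightarrow> (\<exists>z\<in>S. f z = v) \<and> (\<forall>z\<in>S. f z \<le> v)"

definition extremal_point :: "nat \<Rightarrow> int \<Rightarrow> real \<Rightarrow> nat \<Rightarrow> real \<times> real" where
  "extremal_point m r c = (\<lambda>j\<in>{1..m}. if int j \<le> r then (1, 1) else (1/2, c))"

end

theory Submission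
  imports Defs
begin

text \<open>
  The objective is linear in the first coordinates and concave in the second ones, but not
  jointly concave, so the upper bound is obtained from a Lagrangian certificate:
  an affine function of a pair \<open>(t, x)\<close> that dominates \<open>t * ln x\<close> on the
  triangle \<open>1/2 \<le> t \<le> x \<le> 1\<close> and touches it at \<open>(1, 1)\<close> and at \<open>(1/2, c)\<close>
  (\<open>mult_ln_le_affine\<close>).  Adding the \<open>m\<close> inequalities turns the two sum constraints into
  an upper bound for the objective.  For \<open>n < m\<close> the value of \<open>c\<close> is chosen so that the
  configuration consisting of \<open>r\<close> pairs \<open>(1, 1)\<close> and \<open>m - r\<close> pairs \<open>(1/2, c)\<close> satisfies
  both constraints with equality; there every pair is a point of contact, so the bound is
  attained.  For \<open>n \<ge> m\<close> the trivial bound \<open>0\<close> is attained with all \<open>x\<^sub>j = 1\<close> and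
  all first coordinates equal to \<open>k / m\<close>.
\<close>

section \<open>Compactness and range of the parameters\<close>

text \<open>
  Since the points are extensional, the set lies in a product of compact factors indexed
  by all natural numbers, the factors outside \<open>{1..m}\<close> being singletons, and Tychonoff's
  theorem applies.
\<close>

lemma compact_feasible_set: "compact (feasible_set m k n)"
proof -
  define B where
    "B = (\<lambda>j. if j \<in> {1..m} then {1/2..1} \<times> {1/2..1} else {undefined :: real \<times> real})"
  have "compactin (product_topology (\<lambda>_. euclidean) UNIV) (PiE UNIV B)"
    unfolding compactin_PiE by (auto simp: B_def intro: compact_Times)
  then have compact_box: "compact (PiE UNIV B)"
    by (simp add: euclidean_product_topology)
  have fst_cont: "continuous_on UNIV (\<lambda>z :: nat \<Rightarrow> real \<times> real. fst (z j))" for j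
    by (intro continuous_intros continuous_on_product_coordinates)
  have snd_cont: "continuous_on UNIV (\<lambda>z :: nat \<Rightarrow> real \<times> real. snd (z j))" for j
    by (intro continuous_intros continuous_on_product_coordinates)
  define C where "C = {z :: nat \<Rightarrow> real \<times> real.
      (\<forall>j\<in>{1..m}. fst (z j) \<le> snd (z j)) \<and>
      (\<Sum>j=1..m. fst (z j)) = real_of_int k \<and> (\<Sum>j=1..m. snd (z j)) \<le> n}"
  have "closed C"
    unfolding C_def Ball_def
    by (intro closed_Collect_conj closed_Collect_all closed_Collect_imp open_Collect_const
        closed_Collect_le closed_Collect_eq
        continuous_on_sum continuous_on_const fst_cont snd_cont)
  moreover have "feasible_set m k n = PiE UNIV B \<inter> C"
  proof (intro set_eqI iffI)
    fix z
    assume "z \<in> feasible_set m k n"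
    then show "z \<in> PiE UNIV B \<inter> C"
      by (force simp: feasible_set_def B_def C_def PiE_iff extensional_def mem_Times_iff)
  next
    fix z
    assume z: "z \<in> PiE UNIV B \<inter> C"
    then have "z j \<in> B j" for j
      by auto
    then have "z j \<in> {1/2..1} \<times> {1/2..1}" if "j \<in> {1..m}" for j
      using that by (metis B_def)
    moreover have "z j = undefined" if "j \<notin> {1..m}" for j
      using \<open>z j \<in> B j\<close> that by (auto simp: B_def split: if_splits)
    ultimately show "z \<in> feasible_set m k n"
      using z by (auto simp: feasible_set_def C_def PiE_iff extensional_def mem_Times_iff)
  qed
  ultimately show ?thesis
    using compact_box by (simp add: compact_Int_closed)
qed

lemma feasible_set_nonempty_bounds:
  assumes "feasible_set m k n \<noteq> {}"
  shows "real m \<le> 2 * real_of_int k" "real_of_int k \<le> real m" "real_of_int k \<le> n"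
proof -
  obtain z where z: "z \<in> feasible_set m k n"
    using assms by auto
  have "(\<Sum>j=1..m. 1/2) \<le> (\<Sum>j=1..m. fst (z j))" "(\<Sum>j=1..m. fst (z j)) \<le> (\<Sum>j=1..m. 1)"
    "(\<Sum>j=1..m. fst (z j)) \<le> (\<Sum>j=1..m. snd (z j))"
    using z by (intro sum_mono; force simp: feasible_set_def)+
  then show "real m \<le> 2 * real_of_int k" "real_of_int k \<le> real m" "real_of_int k \<le> n"
    using z by (auto simp: feasible_set_def)
qed

section \<open>The affine majorant and the upper bound\<close>

text \<open>
  After division by \<open>x\<close> this says that at \<open>y = 1/x\<close> the concave function \<open>ln\<close> lies above
  its chord over \<open>[1, 2]\<close>.
\<close>

lemma mult_ln_le_chord:
  fixes x :: real
  assumes "1/2 \<le> x" "x \<le> 1"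
  shows "x * ln x \<le> (1 - x) * ln (1/2)"
proof -
  have "concave_on {0<..} (ln :: real \<Rightarrow> real)"
    by (rule ln_concave)
  then have "(1 - (1/x - 1)) * ln 1 + (1/x - 1) * ln 2
      \<le> ln ((1 - (1/x - 1)) *\<^sub>R 1 + (1/x - 1) *\<^sub>R (2::real))"
    by (rule concave_onD) (use assms in \<open>auto simp: field_simps\<close>)
  then have "(1/x - 1) * ln 2 \<le> - ln x"
    using assms by (simp add: ln_div)
  then have "x * ((1/x - 1) * ln 2) \<le> x * (- ln x)"
    using assms by (intro mult_left_mono) auto
  moreover have "x * ((1/x - 1) * ln 2) = (1 - x) * ln 2"
    using assms by (simp add: field_simps)
  ultimately show ?thesis
    by (simp add: ln_div)
qed

text \<open>
  The coefficients are the Lagrange multipliers: the slope \<open>1 / (2 * c)\<close> in \<open>x\<close> makes the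
  right-hand side tangent to \<open>x \<mapsto> ln x / 2\<close> at \<open>c\<close>, and contact at \<open>(1/2, c)\<close> and
  \<open>(1, 1)\<close> determines the rest.  For fixed \<open>x\<close> both sides are affine in \<open>t\<close>, so only
  \<open>t = 1/2\<close> and \<open>t = x\<close> need to be examined.
\<close>

lemma mult_ln_le_affine:
  fixes t x c :: real
  assumes "1/2 \<le> t" "t \<le> x" "x \<le> 1" "0 < c"
  shows "t * ln x \<le> (1 - t) * ln c + (x - (2 * t - 1) - (2 - 2 * t) * c) / (2 * c)"
proof -
  define A where "A = ln x + ln c + 1/c - 1"
  define D where "D = ln c + (x + 1 - 2 * c) / (2 * c)"
  have affine: "s * ln x - ((1 - s) * ln c + (x - (2 * s - 1) - (2 - 2 * s) * c) / (2 * c))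
      = A * s - D" for s
    using assms by (simp add: A_def D_def field_simps)
  have left: "A * (1/2) \<le> D"
  proof -
    have "ln (x / c) \<le> x / c - 1"
      using assms by (intro ln_le_minus_one) auto
    moreover have "ln (x / c) = ln x - ln c"
      using assms by (simp add: ln_div)
    ultimately have "(ln x - ln c) / 2 \<le> (x / c - 1) / 2"
      by (intro divide_right_mono) auto
    also have "\<dots> = (x - c) / (2 * c)"
      using assms by (simp add: field_simps)
    finally show ?thesis
      using affine[of "1/2"] by (simp add: diff_divide_distrib)
  qed
  have right: "A * x \<le> D"
  proof -
    have "ln (1 / (2 * c)) \<le> 1 / (2 * c) - 1"
      using assms by (intro ln_le_minus_one) auto
    then have "ln (1/2) \<le> ln c + (1 / (2 * c) - 1)"
      using assms by (simp add: ln_div ln_mult)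
    then have "(1 - x) * ln (1/2) \<le> (1 - x) * (ln c + (1 / (2 * c) - 1))"
      using assms by (intro mult_left_mono) auto
    then have "x * ln x \<le> (1 - x) * (ln c + (1 / (2 * c) - 1))"
      using mult_ln_le_chord[of x] assms by linarith
    also have "\<dots> = (1 - x) * ln c + (x - (2 * x - 1) - (2 - 2 * x) * c) / (2 * c)"
      using assms by (simp add: field_simps)
    finally show ?thesis
      using affine[of x] by simp
  qed
  have "A * t \<le> D"
  proof (cases "0 \<le> A")
    case True
    then have "A * t \<le> A * x"
      using assms by (intro mult_left_mono)
    then show ?thesis
      using right by linarith
  next
    case False
    then have "A * t \<le> A * (1/2)"
      using assms by (intro mult_left_mono_neg) auto
    then show ?thesis
      using left by linarith
  qed
  then show ?thesis
    using affine[of t] by linarith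
qed

text \<open>
  The assumption on \<open>c\<close> says that the sum of the second coordinates bounded by \<open>n\<close> is
  exhausted by \<open>2 * k - m\<close> ones and \<open>2 * m - 2 * k\<close> copies of \<open>c\<close>; it makes the term
  with the denominator \<open>2 * c\<close> nonpositive after summation.
\<close>

lemma objective_le:
  assumes "z \<in> feasible_set m k n" "0 < c"
    and c: "(2 * real m - 2 * real_of_int k) * c = real m + n - 2 * real_of_int k"
  shows "objective m z \<le> (real m - real_of_int k) * ln c"
proof -
  have z: "1/2 \<le> fst (z j)" "fst (z j) \<le> snd (z j)" "snd (z j) \<le> 1" if "j \<in> {1..m}" for j
    using assms that by (auto simp: feasible_set_def)
  have sums: "(\<Sum>j=1..m. fst (z j)) = real_of_int k" "(\<Sum>j=1..m. snd (z j)) \<le> n"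
    using assms by (auto simp: feasible_set_def)
  have "objective m z \<le> (\<Sum>j=1..m. (1 - fst (z j)) * ln c +
      (snd (z j) - (2 * fst (z j) - 1) - (2 - 2 * fst (z j)) * c) / (2 * c))"
    unfolding objective_def using z assms(2) by (intro sum_mono mult_ln_le_affine) auto
  also have "\<dots> = (\<Sum>j=1..m. 1 - fst (z j)) * ln c +
      ((\<Sum>j=1..m. snd (z j)) - (\<Sum>j=1..m. 2 * fst (z j) - 1)
        - (\<Sum>j=1..m. 2 - 2 * fst (z j)) * c) / (2 * c)"
    by (simp only: sum.distrib sum_subtractf sum_distrib_right[symmetric]
        sum_divide_distrib[symmetric])
  also have "\<dots> = (real m - real_of_int k) * ln c + ((\<Sum>j=1..m. snd (z j)) - n) / (2 * c)"
    using sums(1) c by (simp add: sum_subtractf sum_distrib_left[symmetric] mult.commute)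
  also have "\<dots> \<le> (real m - real_of_int k) * ln c"
    using sums(2) assms(2) by (simp add: divide_le_0_iff)
  finally show ?thesis .
qed

section \<open>The extremal configuration\<close>

lemma sum_threshold:
  fixes a b :: real
  assumes "0 \<le> r" "r \<le> int m"
  shows "(\<Sum>j=1..m. if int j \<le> r then a else b)
    = real_of_int r * a + (real m - real_of_int r) * b"
proof -
  have "{1..m} \<inter> {j. int j \<le> r} = {1..nat r}" "{1..m} \<inter> - {j. int j \<le> r} = {nat r<..m}"
    using assms by auto
  then show ?thesis
    using assms by (simp add: sum.If_cases of_nat_diff)
qed

lemma
  assumes "0 \<le> r" "r \<le> int m"
  shows sum_fst_extremal_point:
      "(\<Sum>j=1..m. fst (extremal_point m r c j)) = (real m + real_of_int r) / 2"
    and sum_snd_extremal_point: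
      "(\<Sum>j=1..m. snd (extremal_point m r c j))
        = real_of_int r + (real m - real_of_int r) * c"
    and objective_extremal_point:
      "objective m (extremal_point m r c) = (real m - real_of_int r) / 2 * ln c"
proof -
  have "(\<Sum>j=1..m. fst (extremal_point m r c j)) = (\<Sum>j=1..m. if int j \<le> r then 1 else 1/2)"
    by (intro sum.cong) (auto simp: extremal_point_def)
  then show "(\<Sum>j=1..m. fst (extremal_point m r c j)) = (real m + real_of_int r) / 2"
    using sum_threshold[OF assms, of 1 "1/2"] by (simp add: field_simps)
  have "(\<Sum>j=1..m. snd (extremal_point m r c j)) = (\<Sum>j=1..m. if int j \<le> r then 1 else c)"
    by (intro sum.cong) (auto simp: extremal_point_def)
  then show "(\<Sum>j=1..m. snd (extremal_point m r c j))
      = real_of_int r + (real m - real_of_int r) * c"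
    using sum_threshold[OF assms, of 1 c] by simp
  have "objective m (extremal_point m r c) = (\<Sum>j=1..m. if int j \<le> r then 0 else ln c / 2)"
    unfolding objective_def by (intro sum.cong) (auto simp: extremal_point_def)
  then show "objective m (extremal_point m r c) = (real m - real_of_int r) / 2 * ln c"
    using sum_threshold[OF assms, of 0 "ln c / 2"] by simp
qed

section \<open>The maximum\<close>

lemma is_maximum_on_objective_slack:
  assumes "feasible_set m k n \<noteq> {}" "real m \<le> n"
  shows "is_maximum_on (objective m) (feasible_set m k n) 0"
proof -
  note bounds = feasible_set_nonempty_bounds[OF assms(1)]
  \<comment> \<open>For \<open>m = 0\<close> the quotient \<open>k / m\<close> is never evaluated: the point is the empty tuple.\<close>
  define z where "z = (\<lambda>j\<in>{1..m}. (real_of_int k / real m, 1 :: real))"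
  have "(\<Sum>j=1..m. fst (z j)) = real_of_int k" "(\<Sum>j=1..m. snd (z j)) = real m"
    using bounds by (auto simp: z_def)
  then have "z \<in> feasible_set m k n"
    using bounds assms(2) by (auto simp: feasible_set_def z_def field_simps)
  moreover have "objective m z = 0"
    by (simp add: objective_def z_def)
  moreover have "objective m y \<le> 0" if "y \<in> feasible_set m k n" for y
  proof -
    have "0 \<le> fst (y j) \<and> ln (snd (y j)) \<le> 0" if "j \<in> {1..m}" for j
    proof -
      have "1/2 \<le> fst (y j)" "fst (y j) \<le> snd (y j)" "snd (y j) \<le> 1"
        using \<open>y \<in> feasible_set m k n\<close> that by (auto simp: feasible_set_def)
      then show ?thesis
        by simp
    qed
    then show ?thesis
      unfolding objective_def by (intro sum_nonpos mult_nonneg_nonpos) auto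
  qed
  ultimately show ?thesis
    by (auto simp: is_maximum_on_def)
qed

theorem proposition10:
  fixes m :: nat and k :: int and n :: real
  assumes "feasible_set m k n \<noteq> {}"
  shows "compact (feasible_set m k n) \<and>
    is_maximum_on (objective m) (feasible_set m k n)
      (if n \<ge> real m then 0
       else if k = int m then 0
       else (real m - real_of_int k) *
              ln ((real m + n - 2 * real_of_int k) / (2 * (real m - real_of_int k)))) \<and>
    (n < real m \<longrightarrow>
      (let r = 2 * k - int m;
           c = (n - real_of_int r) / (real m - real_of_int r)
       in 0 \<le> r \<and> r \<le> int m \<and>
          c = (real m + n - 2 * real_of_int k) / (2 * (real m - real_of_int k)) \<and>
          c \<in> {1/2..<1} \<and>
          extremal_point m r c \<in> feasible_set m k n \<and>
          is_arg_max (objective m) (\<lambda>z. z \<in> feasible_set m k n) (extremal_point m r c)))"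
proof (cases "real m \<le> n")
  case True
  then show ?thesis
    using compact_feasible_set is_maximum_on_objective_slack[OF assms] by auto
next
  case False
  note bounds = feasible_set_nonempty_bounds[OF assms]
  define r where "r = 2 * k - int m"
  define c where "c = (n - real_of_int r) / (real m - real_of_int r)"
  have k_less: "real_of_int k < real m"
    using False bounds by linarith
  have r: "0 \<le> r" "r \<le> int m"
    using bounds unfolding r_def by linarith+
  have r_real: "real_of_int r = 2 * real_of_int k - real m"
    by (simp add: r_def)
  have c_eq: "c = (real m + n - 2 * real_of_int k) / (2 * (real m - real_of_int k))"
    by (simp add: c_def r_real algebra_simps)
  have c_mult: "(2 * real m - 2 * real_of_int k) * c = real m + n - 2 * real_of_int k"
    using k_less by (simp add: c_eq field_simps)
  have c_range: "c \<in> {1/2..<1}"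
    using k_less False bounds by (simp add: c_eq field_simps)
  have "(\<Sum>j=1..m. fst (extremal_point m r c j)) = real_of_int k"
    "(\<Sum>j=1..m. snd (extremal_point m r c j)) = n"
    using c_mult by (simp_all only: sum_fst_extremal_point[OF r] sum_snd_extremal_point[OF r])
      (simp_all add: r_real algebra_simps)
  then have feasible: "extremal_point m r c \<in> feasible_set m k n"
    using c_range by (auto simp: feasible_set_def extremal_point_def)
  have value_eq: "objective m (extremal_point m r c) = (real m - real_of_int k) * ln c"
    by (simp add: objective_extremal_point[OF r] r_real)
  have upper: "objective m z \<le> (real m - real_of_int k) * ln c"
    if "z \<in> feasible_set m k n" for z
    using that c_range c_mult by (intro objective_le) auto
  have maximum: "is_maximum_on (objective m) (feasible_set m k n)
      ((real m - real_of_int k) * ln c)"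
    using feasible value_eq upper by (auto simp: is_maximum_on_def)
  have "is_arg_max (objective m) (\<lambda>z. z \<in> feasible_set m k n) (extremal_point m r c)"
    using feasible value_eq upper by (force simp: is_arg_max_def)
  moreover have "k \<noteq> int m"
    using k_less by auto
  ultimately show ?thesis
    using False compact_feasible_set maximum r c_range feasible c_eq
    unfolding Let_def r_def[symmetric] c_def[symmetric] by simp
qed

end
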